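(* Let $R=\prod_{i=1}^n R_i$ be a finite direct product of rings. Then $R$ is weakly $\delta$-quasipolar if and only if each $R_i$ is weakly $\delta$-quasipolar for $i=1,2,\dots,n$.
   Context: All rings are associative with identity. For $a\in R$, $comm(a)=\{x\in R \mid xa=ax\}$. A right ideal $I$ of $R$ is $\delta$-small if whenever $R=I+K$ with $K$ a right ideal such that $R/K$ is a singular right $R$-module, then $R=K$. $\delta(R)$ is the sum of all $\delta$-small right ideals of $R$; it is a two-sided ideal and equals the intersection of all essential maximal right ideals of $R$ (equal to $R$ if there are none). An element $a\in R$ is weakly $\delta$-quasipolar if there exists $p^2=p\in comm(a)$ such that $a+p\in\delta(R)$; $R$ is weakly $\delta$-quasipolar if every element of $R$ is. *)

theory Defs
  imports "HOL-Algebra.Chinese_Remainder" "HOL-Algebra.Module"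
    "HOL-Algebra.Generated_Groups"
begin

section \<open>Right ideals and right modules\<close>

locale right_ideal = additive_subgroup I R + ring R for I and R (structure) +
  assumes I_r_closed: "\<lbrakk>a \<in> I; x \<in> carrier R\<rbrakk> \<Longrightarrow> a \<otimes> x \<in> I"

text \<open>The library's modules are left modules over commutative rings. A right module over an
  arbitrary ring is given here by the same record type, with \<open>a \<odot>\<^bsub>M\<^esub> x\<close> standing for the
  product \<open>x a\<close>; hence the order of the scalars in \<open>smult_assoc\<close>. The record fields \<open>mult\<close> and
  \<open>one\<close> of \<open>M\<close> play no role.\<close>

locale right_module = R?: ring R + M?: abelian_group M
  for R :: "('a, 'm) ring_scheme" (structure) and M :: "('a, 'b, 'n) module_scheme" (structure) +
  assumes smult_closed:
      "\<lbrakk>a \<in> carrier R; x \<in> carrier M\<rbrakk> \<Longrightarrow> a \<odot>\<^bsub>M\<^esub> x \<in> carrier M"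
    and smult_l_distr:
      "\<lbrakk>a \<in> carrier R; b \<in> carrier R; x \<in> carrier M\<rbrakk> \<Longrightarrow>
        (a \<oplus>\<^bsub>R\<^esub> b) \<odot>\<^bsub>M\<^esub> x = a \<odot>\<^bsub>M\<^esub> x \<oplus>\<^bsub>M\<^esub> b \<odot>\<^bsub>M\<^esub> x"
    and smult_r_distr:
      "\<lbrakk>a \<in> carrier R; x \<in> carrier M; y \<in> carrier M\<rbrakk> \<Longrightarrow>
        a \<odot>\<^bsub>M\<^esub> (x \<oplus>\<^bsub>M\<^esub> y) = a \<odot>\<^bsub>M\<^esub> x \<oplus>\<^bsub>M\<^esub> a \<odot>\<^bsub>M\<^esub> y"
    and smult_assoc:
      "\<lbrakk>a \<in> carrier R; b \<in> carrier R; x \<in> carrier M\<rbrakk> \<Longrightarrow>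
        (a \<otimes>\<^bsub>R\<^esub> b) \<odot>\<^bsub>M\<^esub> x = b \<odot>\<^bsub>M\<^esub> (a \<odot>\<^bsub>M\<^esub> x)"
    and smult_one:
      "x \<in> carrier M \<Longrightarrow> \<one>\<^bsub>R\<^esub> \<odot>\<^bsub>M\<^esub> x = x"

definition right_quotient :: "('a, 'm) ring_scheme \<Rightarrow> 'a set \<Rightarrow> ('a, 'a set) module"
  where "right_quotient R K =
    \<lparr>carrier = a_rcosets\<^bsub>R\<^esub> K, mult = undefined, one = undefined,
     zero = K, add = set_add R,
     smult = (\<lambda>r A. \<Union>x\<in>A. K +>\<^bsub>R\<^esub> (x \<otimes>\<^bsub>R\<^esub> r))\<rparr>"

lemma right_quotient_module:
  fixes R (structure)
  assumes "right_ideal K R" shows "right_module R (right_quotient R K)"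
proof -
  interpret right_ideal K R by fact
  interpret abelian_subgroup K R
    by (intro abelian_subgroupI3 is_additive_subgroup) unfold_locales
  have car: "carrier (right_quotient R K) = {K +> x |x. x \<in> carrier R}"
    by (auto simp: right_quotient_def A_RCOSETS_def')
  have add: "(K +> x) \<oplus>\<^bsub>right_quotient R K\<^esub> (K +> y) = K +> (x \<oplus> y)"
    if "x \<in> carrier R" "y \<in> carrier R" for x y
    using that by (simp add: right_quotient_def a_rcos_sum)
  have z: "\<zero>\<^bsub>right_quotient R K\<^esub> = K +> \<zero>"
    using a_coset_add_zero[OF a_subset] by (simp add: right_quotient_def)
  have sm: "r \<odot>\<^bsub>right_quotient R K\<^esub> (K +> x) = K +> (x \<otimes> r)"
    if x: "x \<in> carrier R" "r \<in> carrier R" for x r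
  proof -
    have *: "K +> (y \<otimes> r) = K +> (x \<otimes> r)" if y: "y \<in> K +> x" for y
    proof -
      obtain k where k: "k \<in> K" "y = k \<oplus> x" using y by (auto simp: a_r_coset_def')
      have kc: "k \<in> carrier R" using k(1) by (rule a_Hcarr)
      have "y \<otimes> r = k \<otimes> r \<oplus> x \<otimes> r" using k x kc by (simp add: l_distr)
      then have "y \<otimes> r \<in> K +> (x \<otimes> r)"
        using I_r_closed[OF k(1) x(2)] by (auto simp: a_r_coset_def')
      then show ?thesis using x by (metis a_repr_independence' m_closed)
    qed
    have "(\<Union>y\<in>K +> x. K +> (y \<otimes> r)) = (\<Union>y\<in>K +> x. K +> (x \<otimes> r))"
      by (rule SUP_cong[OF refl *])
    also have "\<dots> = K +> (x \<otimes> r)"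
      using a_rcos_self[OF x(1)] by blast
    finally show ?thesis by (simp add: right_quotient_def)
  qed
  have ab: "abelian_group (right_quotient R K)"
  proof (rule abelian_groupI)
    fix x assume "x \<in> carrier (right_quotient R K)"
    then obtain a where a: "a \<in> carrier R" "x = K +> a" by (auto simp: car)
    have "(K +> (\<ominus> a)) \<oplus>\<^bsub>right_quotient R K\<^esub> x = \<zero>\<^bsub>right_quotient R K\<^esub>"
      using a by (simp add: add z l_neg)
    then show "\<exists>y\<in>carrier (right_quotient R K). y \<oplus>\<^bsub>right_quotient R K\<^esub> x = \<zero>\<^bsub>right_quotient R K\<^esub>"
      using a(1) unfolding car by blast
  next
    show "\<zero>\<^bsub>right_quotient R K\<^esub> \<in> carrier (right_quotient R K)" unfolding car z by blast
  next
    fix x y assume "x \<in> carrier (right_quotient R K)" "y \<in> carrier (right_quotient R K)"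
    then obtain a b where ab: "a \<in> carrier R" "x = K +> a" "b \<in> carrier R" "y = K +> b" by (auto simp: car)
    show "x \<oplus>\<^bsub>right_quotient R K\<^esub> y \<in> carrier (right_quotient R K)" 
      unfolding ab(2,4) add[OF ab(1,3)] car using ab(1,3) by blast
    show "x \<oplus>\<^bsub>right_quotient R K\<^esub> y = y \<oplus>\<^bsub>right_quotient R K\<^esub> x" using ab by (simp add: add a_comm)
    fix w assume "w \<in> carrier (right_quotient R K)"
    then obtain c where c: "c \<in> carrier R" "w = K +> c" by (auto simp: car)
    show "x \<oplus>\<^bsub>right_quotient R K\<^esub> y \<oplus>\<^bsub>right_quotient R K\<^esub> w = x \<oplus>\<^bsub>right_quotient R K\<^esub> (y \<oplus>\<^bsub>right_quotient R K\<^esub> w)"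
      using ab c by (simp add: add a_assoc)
  next
    fix x assume "x \<in> carrier (right_quotient R K)"
    then obtain a where a: "a \<in> carrier R" "x = K +> a" by (auto simp: car)
    show "\<zero>\<^bsub>right_quotient R K\<^esub> \<oplus>\<^bsub>right_quotient R K\<^esub> x = x" using a by (simp add: add z)
  qed
  have ax: "right_module_axioms R (right_quotient R K)"
  proof (rule right_module_axioms.intro)
    fix a b x assume *: "a \<in> carrier R" "b \<in> carrier R" "x \<in> carrier (right_quotient R K)"
    then obtain c where c: "c \<in> carrier R" "x = K +> c" by (auto simp: car)
    show "(a \<oplus> b) \<odot>\<^bsub>right_quotient R K\<^esub> x =
        a \<odot>\<^bsub>right_quotient R K\<^esub> x \<oplus>\<^bsub>right_quotient R K\<^esub> b \<odot>\<^bsub>right_quotient R K\<^esub> x"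
      using * c by (simp add: sm add r_distr)
    show "(a \<otimes> b) \<odot>\<^bsub>right_quotient R K\<^esub> x =
        b \<odot>\<^bsub>right_quotient R K\<^esub> (a \<odot>\<^bsub>right_quotient R K\<^esub> x)"
      using * c by (simp add: sm m_assoc)
  next
    fix a x y assume *: "a \<in> carrier R" "x \<in> carrier (right_quotient R K)"
      "y \<in> carrier (right_quotient R K)"
    then obtain c d where c: "c \<in> carrier R" "x = K +> c" "d \<in> carrier R" "y = K +> d"
      by (auto simp: car)
    show "a \<odot>\<^bsub>right_quotient R K\<^esub> (x \<oplus>\<^bsub>right_quotient R K\<^esub> y) =
        a \<odot>\<^bsub>right_quotient R K\<^esub> x \<oplus>\<^bsub>right_quotient R K\<^esub> a \<odot>\<^bsub>right_quotient R K\<^esub> y"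
      using * c by (simp add: sm add l_distr)
  next
    fix a x assume *: "a \<in> carrier R" "x \<in> carrier (right_quotient R K)"
    then obtain c where c: "c \<in> carrier R" "x = K +> c" by (auto simp: car)
    show "a \<odot>\<^bsub>right_quotient R K\<^esub> x \<in> carrier (right_quotient R K)"
      unfolding c(2) sm[OF c(1) *(1)] car using c(1) *(1) by blast
  next
    fix x assume "x \<in> carrier (right_quotient R K)"
    then obtain c where c: "c \<in> carrier R" "x = K +> c" by (auto simp: car)
    show "\<one> \<odot>\<^bsub>right_quotient R K\<^esub> x = x" using c by (simp add: sm)
  qed
  show ?thesis
    by (intro right_module.intro ax ab ring_axioms)
qed

section \<open>Singular modules\<close>

definition essential_right_ideal :: "('a, 'm) ring_scheme \<Rightarrow> 'a set \<Rightarrow> bool"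
  where "essential_right_ideal R E \<longleftrightarrow>
    right_ideal E R \<and> (\<forall>J. right_ideal J R \<and> J \<noteq> {\<zero>\<^bsub>R\<^esub>} \<longrightarrow> E \<inter> J \<noteq> {\<zero>\<^bsub>R\<^esub>})"

definition annihilator ::
    "('a, 'm) ring_scheme \<Rightarrow> ('a, 'b, 'n) module_scheme \<Rightarrow> 'b \<Rightarrow> 'a set"
  where "annihilator R M x = {r \<in> carrier R. r \<odot>\<^bsub>M\<^esub> x = \<zero>\<^bsub>M\<^esub>}"

definition singular_submodule ::
    "('a, 'm) ring_scheme \<Rightarrow> ('a, 'b, 'n) module_scheme \<Rightarrow> 'b set"
  where "singular_submodule R M =
    {x \<in> carrier M. essential_right_ideal R (annihilator R M x)}"

definition singular_module ::
    "('a, 'm) ring_scheme \<Rightarrow> ('a, 'b, 'n) module_scheme \<Rightarrow> bool"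
  where "singular_module R M \<longleftrightarrow> right_module R M \<and> singular_submodule R M = carrier M"

section \<open>Weakly delta-quasipolar rings\<close>

definition delta_small :: "('a, 'm) ring_scheme \<Rightarrow> 'a set \<Rightarrow> bool"
  where "delta_small R I \<longleftrightarrow> right_ideal I R \<and>
    (\<forall>K. right_ideal K R \<and> singular_module R (right_quotient R K) \<and>
         carrier R = I <+>\<^bsub>R\<^esub> K \<longrightarrow> carrier R = K)"

text \<open>The sum of a family of right ideals is the additive subgroup generated by their union.\<close>

definition delta :: "('a, 'm) ring_scheme \<Rightarrow> 'a set"
  where "delta R = generate (add_monoid R) (\<Union>{I. delta_small R I})"

definition comm :: "('a, 'm) ring_scheme \<Rightarrow> 'a \<Rightarrow> 'a set"
  where "comm R a = {x \<in> carrier R. x \<otimes>\<^bsub>R\<^esub> a = a \<otimes>\<^bsub>R\<^esub> x}"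

definition weakly_delta_quasipolar_element :: "('a, 'm) ring_scheme \<Rightarrow> 'a \<Rightarrow> bool"
  where "weakly_delta_quasipolar_element R a \<longleftrightarrow>
    (\<exists>p \<in> comm R a. p \<otimes>\<^bsub>R\<^esub> p = p \<and> a \<oplus>\<^bsub>R\<^esub> p \<in> delta R)"

definition weakly_delta_quasipolar :: "('a, 'm) ring_scheme \<Rightarrow> bool"
  where "weakly_delta_quasipolar R \<longleftrightarrow>
    (\<forall>a \<in> carrier R. weakly_delta_quasipolar_element R a)"

end

theory Submission
  imports Defs
begin

text \<open>A surjective ring homomorphism pulls essential right ideals back to essential right ideals,
  hence maps \<open>\<delta>\<close>-small right ideals to \<open>\<delta>\<close>-small ones. Conversely, the inclusion \<open>\<iota>\<close> of a direct
  factor \<open>S\<close> of \<open>R\<close> preserves \<open>\<delta>\<close>-smallness: if \<open>R = \<iota>(J) + K\<close> with \<open>R/K\<close> singular, then the image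
  of \<open>K\<close> in \<open>S\<close> has singular quotient and is all of \<open>S\<close>, so \<open>K\<close> contains \<open>\<iota>(1)\<close> and therefore \<open>\<iota>(J)\<close>.
  Thus \<open>\<delta>\<close> is computed componentwise, and so are the idempotents witnessing quasipolarity.\<close>

section \<open>Right ideals and singular quotients in terms of elements\<close>

text \<open>Negatives come from right multiplication by -1, since -a = a(-1). Later checks that a
  set is a right ideal reduce to this criterion.\<close>

lemma right_ideal_iff:
  assumes "ring R"
  shows "right_ideal I R \<longleftrightarrow> I \<subseteq> carrier R \<and> \<zero>\<^bsub>R\<^esub> \<in> I \<and> (\<forall>a\<in>I. \<forall>b\<in>I. a \<oplus>\<^bsub>R\<^esub> b \<in> I)
    \<and> (\<forall>a\<in>I. \<forall>x\<in>carrier R. a \<otimes>\<^bsub>R\<^esub> x \<in> I)" (is "_ \<longleftrightarrow> ?rhs")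
proof
  assume "right_ideal I R"
  then interpret right_ideal I R .
  show ?rhs
    using I_r_closed a_closed zero_closed a_subset by auto
next
  interpret ring R by fact
  assume rhs: ?rhs
  have "\<ominus>\<^bsub>R\<^esub> a \<in> I" if "a \<in> I" for a
  proof -
    have "a \<in> carrier R" using that rhs by auto
    then have "\<ominus>\<^bsub>R\<^esub> a = a \<otimes>\<^bsub>R\<^esub> (\<ominus>\<^bsub>R\<^esub> \<one>\<^bsub>R\<^esub>)" by (simp add: r_minus)
    then show ?thesis using rhs that by simp
  qed
  then have "subgroup I (add_monoid R)"
    using rhs by (intro subgroup.intro) (auto simp flip: a_inv_def)
  then show "right_ideal I R"
    using rhs by (intro right_ideal.intro additive_subgroup.intro right_ideal_axioms.intro assms) auto
qed

text \<open>This set is the annihilator of the coset of \<open>x\<close> in R/K, the right ideal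
  whose essentiality decides singularity.\<close>

lemma right_ideal_transporter:
  assumes "right_ideal K R" "x \<in> carrier R"
  shows "right_ideal {r \<in> carrier R. x \<otimes>\<^bsub>R\<^esub> r \<in> K} R"
proof -
  interpret right_ideal K R by fact
  show ?thesis
    using assms(2) I_r_closed by (auto simp: right_ideal_iff[OF ring_axioms] r_distr simp flip: m_assoc)
qed

text \<open>Every element of R/K is a coset K + x, and r kills it exactly when xr lies in K.
  Singularity thus becomes a condition on right ideals of \<open>R\<close> alone, which the later
  arguments use instead of the quotient module.\<close>

lemma singular_right_quotient_iff:
  fixes R (structure)
  assumes "right_ideal K R"
  shows "singular_module R (right_quotient R K) \<longleftrightarrow>
    (\<forall>x\<in>carrier R. essential_right_ideal R {r \<in> carrier R. x \<otimes> r \<in> K})"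
proof -
  interpret right_ideal K R by fact
  interpret abelian_subgroup K R
    by (intro abelian_subgroupI3 is_additive_subgroup) unfold_locales
  have car: "carrier (right_quotient R K) = {K +> x |x. x \<in> carrier R}"
    by (auto simp: right_quotient_def A_RCOSETS_def')
  have sm: "r \<odot>\<^bsub>right_quotient R K\<^esub> (K +> x) = K +> (x \<otimes> r)"
    if x: "x \<in> carrier R" "r \<in> carrier R" for x r
  proof -
    \<comment> \<open>The action on a coset is a union over its representatives. Passing from x to k
      + x changes xr by kr, which lies in K, so all terms of the union are the same coset.\<close>
    have "K +> (y \<otimes> r) = K +> (x \<otimes> r)" if y: "y \<in> K +> x" for y
    proof -
      obtain k where k: "k \<in> K" "y = k \<oplus> x" using y by (auto simp: a_r_coset_def')
      have "y \<otimes> r = k \<otimes> r \<oplus> x \<otimes> r" using k x a_Hcarr[OF k(1)] by (simp add: l_distr)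
      then have "y \<otimes> r \<in> K +> (x \<otimes> r)"
        using I_r_closed[OF k(1) x(2)] by (auto simp: a_r_coset_def')
      then show ?thesis using x by (metis a_repr_independence' m_closed)
    qed
    then have "(\<Union>y\<in>K +> x. K +> (y \<otimes> r)) = (\<Union>y\<in>K +> x. K +> (x \<otimes> r))"
      by (rule SUP_cong[OF refl])
    then show ?thesis using a_rcos_self[OF x(1)] by (auto simp: right_quotient_def)
  qed
  have eq: "K +> y = K \<longleftrightarrow> y \<in> K" if "y \<in> carrier R" for y
    using that a_rcos_self a_rcos_const by blast
  have "annihilator R (right_quotient R K) (K +> x) = {r \<in> carrier R. x \<otimes> r \<in> K}"
    if "x \<in> carrier R" for x
  proof -
    have "r \<odot>\<^bsub>right_quotient R K\<^esub> (K +> x) = \<zero>\<^bsub>right_quotient R K\<^esub> \<longleftrightarrow> x \<otimes> r \<in> K"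
      if "r \<in> carrier R" for r
      unfolding sm[OF \<open>x \<in> carrier R\<close> that] using that \<open>x \<in> carrier R\<close>
      by (simp add: right_quotient_def eq)
    then show ?thesis unfolding annihilator_def by blast
  qed
  moreover have "singular_module R (right_quotient R K) \<longleftrightarrow>
      (\<forall>A\<in>carrier (right_quotient R K). essential_right_ideal R (annihilator R (right_quotient R K) A))"
    using right_quotient_module[OF assms]
    unfolding singular_module_def singular_submodule_def by blast
  ultimately show ?thesis unfolding car by auto
qed

section \<open>Transport of \<delta> along additive maps\<close>

text \<open>A homomorphism maps the subgroup generated by a set onto the subgroup generated by its
  image, so only the generators have to be controlled. Since \<open>h\<close> is merely additive,
  this serves both the projection and the inclusion of a direct factor.\<close>

lemma delta_image_subset:
  assumes "group_hom (add_monoid R) (add_monoid S) h"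
    and "\<And>I. delta_small R I \<Longrightarrow> delta_small S (h ` I)"
  shows "h ` delta R \<subseteq> delta S"
proof -
  interpret group_hom "add_monoid R" "add_monoid S" h by fact
  have sub: "\<Union>{I. delta_small R I} \<subseteq> carrier (add_monoid R)"
    by (auto simp: delta_small_def right_ideal_def dest: additive_subgroup.a_Hcarr)
  have "h ` delta R = generate (add_monoid S) (h ` \<Union>{I. delta_small R I})"
    unfolding delta_def by (rule generate_img[OF sub, symmetric])
  also have "\<dots> \<subseteq> delta S"
    unfolding delta_def by (rule H.mono_generate) (use assms(2) in blast)
  finally show ?thesis .
qed

lemma add_mem_delta:
  assumes "a \<in> delta R" "b \<in> delta R"
  shows "a \<oplus>\<^bsub>R\<^esub> b \<in> delta R"
  using generate.eng[of a "add_monoid R" _ b] assms by (simp add: delta_def)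

section \<open>Surjective ring homomorphisms\<close>

locale surj_ring_hom = ring_hom_ring R S h for R S h +
  assumes surj: "h ` carrier R = carrier S"
begin

text \<open>Surjectivity lifts each scalar of \<open>S\<close> to \<open>R\<close>, where
  \<open>I\<close> absorbs it.\<close>

lemma right_ideal_image:
  assumes "right_ideal I R"
  shows "right_ideal (h ` I) S"
proof -
  interpret I: right_ideal I R by fact
  have I: "I \<subseteq> carrier R" by (rule I.a_subset)
  show ?thesis
    unfolding right_ideal_iff[OF S.ring_axioms]
  proof (intro conjI ballI)
    show "h ` I \<subseteq> carrier S" using I surj by blast
    show "\<zero>\<^bsub>S\<^esub> \<in> h ` I" using imageI[OF I.zero_closed, of h] by simp
  next
    fix a b assume "a \<in> h ` I" "b \<in> h ` I"
    then obtain i j where ij: "i \<in> I" "a = h i" "j \<in> I" "b = h j" by auto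
    then have "a \<oplus>\<^bsub>S\<^esub> b = h (i \<oplus>\<^bsub>R\<^esub> j)" using I by auto
    then show "a \<oplus>\<^bsub>S\<^esub> b \<in> h ` I" using I.a_closed ij by blast
  next
    fix a x assume "a \<in> h ` I" "x \<in> carrier S"
    then obtain i y where iy: "i \<in> I" "a = h i" "y \<in> carrier R" "x = h y" using surj by blast
    then have "a \<otimes>\<^bsub>S\<^esub> x = h (i \<otimes>\<^bsub>R\<^esub> y)" using I by auto
    then show "a \<otimes>\<^bsub>S\<^esub> x \<in> h ` I" using I.I_r_closed iy by blast
  qed
qed

lemma right_ideal_vimage:
  assumes "right_ideal K S"
  shows "right_ideal {x \<in> carrier R. h x \<in> K} R"
  using assms by (simp add: right_ideal_iff[OF R.ring_axioms] right_ideal_iff[OF S.ring_axioms])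

text \<open>A nonzero right ideal J of \<open>R\<close> either lies in the kernel of
  \<open>h\<close>, and then inside the preimage of \<open>E\<close>, or has a nonzero image. In the
  latter case \<open>E\<close> contains some nonzero h(j) with j in J, and this j is itself
  nonzero.\<close>

lemma essential_right_ideal_vimage:
  assumes "essential_right_ideal S E"
  shows "essential_right_ideal R {x \<in> carrier R. h x \<in> E}"
  unfolding essential_right_ideal_def
proof (intro conjI allI impI)
  have E: "right_ideal E S" using assms by (simp add: essential_right_ideal_def)
  then show "right_ideal {x \<in> carrier R. h x \<in> E} R" by (rule right_ideal_vimage)
  fix J assume "right_ideal J R \<and> J \<noteq> {\<zero>\<^bsub>R\<^esub>}"
  then have J: "right_ideal J R" "J \<noteq> {\<zero>\<^bsub>R\<^esub>}" by auto
  have hJ: "right_ideal (h ` J) S" by (rule right_ideal_image[OF J(1)])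
  have Jsub: "J \<subseteq> carrier R" using J(1) by (simp add: right_ideal_iff[OF R.ring_axioms])
  \<comment> \<open>Both sets contain zero, so an intersection different from the zero singleton
    must have a nonzero element.\<close>
  have zE: "\<zero>\<^bsub>S\<^esub> \<in> E" "\<zero>\<^bsub>S\<^esub> \<in> h ` J"
    using E hJ by (simp_all add: right_ideal_iff[OF S.ring_axioms])
  show "{x \<in> carrier R. h x \<in> E} \<inter> J \<noteq> {\<zero>\<^bsub>R\<^esub>}"
  proof (cases "h ` J = {\<zero>\<^bsub>S\<^esub>}")
    case True
    then have "h x \<in> E" if "x \<in> J" for x using zE(1) imageI[OF that, of h] by simp
    then have "{x \<in> carrier R. h x \<in> E} \<inter> J = J" using Jsub by auto
    with J(2) show ?thesis by simp
  next
    case False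
    then have "E \<inter> h ` J \<noteq> {\<zero>\<^bsub>S\<^esub>}"
      using assms hJ by (simp add: essential_right_ideal_def)
    then obtain j where "j \<in> J" "h j \<in> E" "h j \<noteq> \<zero>\<^bsub>S\<^esub>" using zE by blast
    moreover from this have "j \<in> {x \<in> carrier R. h x \<in> E} \<inter> J" "j \<noteq> \<zero>\<^bsub>R\<^esub>"
      using Jsub by auto
    ultimately show ?thesis by blast
  qed
qed

text \<open>A test ideal K of \<open>S\<close> is pulled back to \<open>R\<close>: its preimage
  again has singular quotient and complements \<open>I\<close> to all of \<open>R\<close>. Smallness
  of \<open>I\<close> makes the preimage equal to \<open>R\<close>, and surjectivity gives K =
  S.\<close>

lemma delta_small_image:
  assumes "delta_small R I"
  shows "delta_small S (h ` I)"
  unfolding delta_small_def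
proof (intro conjI allI impI)
  have I: "right_ideal I R" using assms by (simp add: delta_small_def)
  then have Isub: "I \<subseteq> carrier R" by (simp add: right_ideal_iff[OF R.ring_axioms])
  show "right_ideal (h ` I) S" by (rule right_ideal_image[OF I])
  fix K assume *: "right_ideal K S \<and> singular_module S (right_quotient S K) \<and>
    carrier S = h ` I <+>\<^bsub>S\<^esub> K"
  then have K: "right_ideal K S" and sing: "singular_module S (right_quotient S K)"
    and sum: "carrier S = h ` I <+>\<^bsub>S\<^esub> K" by iprover+
  have Ksub: "K \<subseteq> carrier S" using K by (simp add: right_ideal_iff[OF S.ring_axioms])
  let ?K = "{x \<in> carrier R. h x \<in> K}"
  have rK: "right_ideal ?K R" by (rule right_ideal_vimage[OF K])
  have "essential_right_ideal R {r \<in> carrier R. x \<otimes>\<^bsub>R\<^esub> r \<in> ?K}" if x: "x \<in> carrier R" for x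
  proof -
    \<comment> \<open>Annihilators pull back: that of x modulo the preimage of K is the preimage of
      that of h(x) modulo K.\<close>
    have "{r \<in> carrier R. x \<otimes>\<^bsub>R\<^esub> r \<in> ?K} =
        {r \<in> carrier R. h r \<in> {s \<in> carrier S. h x \<otimes>\<^bsub>S\<^esub> s \<in> K}}"
      using x by auto
    moreover have "essential_right_ideal S {s \<in> carrier S. h x \<otimes>\<^bsub>S\<^esub> s \<in> K}"
      using sing x by (simp add: singular_right_quotient_iff[OF K])
    ultimately show ?thesis by (simp only: essential_right_ideal_vimage)
  qed
  then have "singular_module R (right_quotient R ?K)"
    unfolding singular_right_quotient_iff[OF rK] by blast
  moreover have "carrier R = I <+>\<^bsub>R\<^esub> ?K"
  proof
    show "carrier R \<subseteq> I <+>\<^bsub>R\<^esub> ?K"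
    proof
      fix x assume x: "x \<in> carrier R"
      then have "h x \<in> h ` I <+>\<^bsub>S\<^esub> K" unfolding sum[symmetric] by simp
      then obtain i k where ik: "i \<in> I" "k \<in> K" "h x = h i \<oplus>\<^bsub>S\<^esub> k"
        by (auto simp: set_add_def')
      have i: "i \<in> carrier R" using ik Isub by auto
      have k: "k \<in> carrier S" using ik Ksub by auto
      \<comment> \<open>Subtracting the lift i of the first summand leaves an element with image k,
        hence one in the preimage of K.\<close>
      have "h (\<ominus>\<^bsub>R\<^esub> i \<oplus>\<^bsub>R\<^esub> x) = k"
        using x i ik k by (simp add: S.r_neg1)
      then have "\<ominus>\<^bsub>R\<^esub> i \<oplus>\<^bsub>R\<^esub> x \<in> ?K" using ik x i by simp
      moreover have "x = i \<oplus>\<^bsub>R\<^esub> (\<ominus>\<^bsub>R\<^esub> i \<oplus>\<^bsub>R\<^esub> x)" using x i by (simp add: R.r_neg2)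
      ultimately show "x \<in> I <+>\<^bsub>R\<^esub> ?K" using ik(1) unfolding set_add_def' by blast
    qed
    show "I <+>\<^bsub>R\<^esub> ?K \<subseteq> carrier R" using Isub by (intro R.set_add_closed) auto
  qed
  ultimately have "carrier R = ?K" using assms rK unfolding delta_small_def by blast
  then have "h x \<in> K" if "x \<in> carrier R" for x using that by blast
  then have "h ` carrier R \<subseteq> K" by blast
  then show "carrier S = K" using Ksub unfolding surj by blast
qed

lemma delta_image: "h ` delta R \<subseteq> delta S"
proof (rule delta_image_subset)
  show "group_hom (add_monoid R) (add_monoid S) h" by (rule a_group_hom)
qed (rule delta_small_image)

end

section \<open>Direct factors of a ring\<close>

text \<open>The multiplicativity of \<open>\<iota>\<close> and the fact that \<open>\<iota>(1)\<close> is a central idempotent of \<open>R\<close> are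
  encoded in the two projection formulas.\<close>

locale ring_direct_factor = ring_hom_ring R S \<pi> for R S \<pi> +
  fixes \<iota>
  assumes incl_closed: "y \<in> carrier S \<Longrightarrow> \<iota> y \<in> carrier R"
    and incl_add: "\<lbrakk>y \<in> carrier S; z \<in> carrier S\<rbrakk> \<Longrightarrow> \<iota> (y \<oplus>\<^bsub>S\<^esub> z) = \<iota> y \<oplus>\<^bsub>R\<^esub> \<iota> z"
    and proj_incl: "y \<in> carrier S \<Longrightarrow> \<pi> (\<iota> y) = y"
    and incl_mult_right: "\<lbrakk>y \<in> carrier S; x \<in> carrier R\<rbrakk> \<Longrightarrow> \<iota> y \<otimes>\<^bsub>R\<^esub> x = \<iota> (y \<otimes>\<^bsub>S\<^esub> \<pi> x)"
    and incl_mult_left: "\<lbrakk>y \<in> carrier S; x \<in> carrier R\<rbrakk> \<Longrightarrow> x \<otimes>\<^bsub>R\<^esub> \<iota> y = \<iota> (\<pi> x \<otimes>\<^bsub>S\<^esub> y)"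
begin

sublocale surj_ring_hom R S \<pi>
proof
  have "y \<in> \<pi> ` carrier R" if "y \<in> carrier S" for y
    using incl_closed[OF that] proj_incl[OF that] by (rule rev_image_eqI[OF _ sym])
  then show "\<pi> ` carrier R = carrier S" by auto
qed

lemma incl_group_hom: "group_hom (add_monoid S) (add_monoid R) \<iota>"
  by (intro group_hom.intro group_hom_axioms.intro R.a_group S.a_group)
    (auto simp: hom_def incl_closed incl_add)

lemma incl_zero: "\<iota> \<zero>\<^bsub>S\<^esub> = \<zero>\<^bsub>R\<^esub>"
  using group_hom.hom_one[OF incl_group_hom] by simp

text \<open>By \<open>incl_mult_right\<close>, a scalar of \<open>R\<close> acts on \<iota>(j)
  through its projection to \<open>S\<close>, where \<open>J\<close> absorbs it.\<close>

lemma right_ideal_incl_image: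
  assumes "right_ideal J S"
  shows "right_ideal (\<iota> ` J) R"
proof -
  have J: "J \<subseteq> carrier S" "\<zero>\<^bsub>S\<^esub> \<in> J" "\<And>a b. a \<in> J \<Longrightarrow> b \<in> J \<Longrightarrow> a \<oplus>\<^bsub>S\<^esub> b \<in> J"
    "\<And>a x. a \<in> J \<Longrightarrow> x \<in> carrier S \<Longrightarrow> a \<otimes>\<^bsub>S\<^esub> x \<in> J"
    using assms by (simp_all add: right_ideal_iff[OF S.ring_axioms])
  show ?thesis
    unfolding right_ideal_iff[OF R.ring_axioms]
  proof (intro conjI ballI)
    show "\<iota> ` J \<subseteq> carrier R" using J(1) incl_closed by blast
    show "\<zero>\<^bsub>R\<^esub> \<in> \<iota> ` J" using imageI[OF J(2), of \<iota>] incl_zero by simp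
  next
    fix a b assume "a \<in> \<iota> ` J" "b \<in> \<iota> ` J"
    then obtain i j where ij: "i \<in> J" "a = \<iota> i" "j \<in> J" "b = \<iota> j" by auto
    then have "a \<oplus>\<^bsub>R\<^esub> b = \<iota> (i \<oplus>\<^bsub>S\<^esub> j)" using J(1) by (simp add: incl_add subset_iff)
    then show "a \<oplus>\<^bsub>R\<^esub> b \<in> \<iota> ` J" using J(3) ij by blast
  next
    fix a x assume "a \<in> \<iota> ` J" and x: "x \<in> carrier R"
    then obtain j where j: "j \<in> J" "a = \<iota> j" by auto
    then have "a \<otimes>\<^bsub>R\<^esub> x = \<iota> (j \<otimes>\<^bsub>S\<^esub> \<pi> x)" using J(1) x incl_mult_right by auto
    then show "a \<otimes>\<^bsub>R\<^esub> x \<in> \<iota> ` J" using J(4) j x by simp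
  qed
qed

text \<open>Essentiality in \<open>S\<close> is tested in \<open>R\<close>. A nonzero right ideal N
  of \<open>S\<close> has nonzero image under \<iota>, because \<pi> is a left inverse of \<iota>;
  so this image meets the annihilator of the coset of \<iota>(x) in some nonzero \<iota>(n).\<close>

lemma singular_quotient_proj_image:
  assumes K: "right_ideal K R" and sing: "singular_module R (right_quotient R K)"
  shows "singular_module S (right_quotient S (\<pi> ` K))"
  unfolding singular_right_quotient_iff[OF right_ideal_image[OF K]]
proof
  fix x assume x: "x \<in> carrier S"
  let ?F = "{r \<in> carrier S. x \<otimes>\<^bsub>S\<^esub> r \<in> \<pi> ` K}"
  have E: "essential_right_ideal R {r \<in> carrier R. \<iota> x \<otimes>\<^bsub>R\<^esub> r \<in> K}"
    using sing incl_closed[OF x] by (simp add: singular_right_quotient_iff[OF K])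
  show "essential_right_ideal S ?F"
    unfolding essential_right_ideal_def
  proof (intro conjI allI impI)
    show "right_ideal ?F S" by (rule right_ideal_transporter[OF right_ideal_image[OF K] x])
    fix N assume "right_ideal N S \<and> N \<noteq> {\<zero>\<^bsub>S\<^esub>}"
    then have N: "right_ideal N S" "N \<noteq> {\<zero>\<^bsub>S\<^esub>}" by auto
    have Nsub: "N \<subseteq> carrier S" "\<zero>\<^bsub>S\<^esub> \<in> N" using N(1) by (simp_all add: right_ideal_iff[OF S.ring_axioms])
    have "\<iota> ` N \<noteq> {\<zero>\<^bsub>R\<^esub>}"
    proof
      assume *: "\<iota> ` N = {\<zero>\<^bsub>R\<^esub>}"
      have "n = \<zero>\<^bsub>S\<^esub>" if "n \<in> N" for n
      proof -
        have "\<iota> n = \<zero>\<^bsub>R\<^esub>" using * that by blast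
        then show ?thesis using proj_incl[of n] that Nsub by auto
      qed
      then show False using N(2) Nsub(2) by blast
    qed
    then have "{r \<in> carrier R. \<iota> x \<otimes>\<^bsub>R\<^esub> r \<in> K} \<inter> \<iota> ` N \<noteq> {\<zero>\<^bsub>R\<^esub>}" (is "?E \<inter> _ \<noteq> _")
      using E right_ideal_incl_image[OF N(1)] by (simp add: essential_right_ideal_def)
    moreover have "\<zero>\<^bsub>R\<^esub> \<in> ?E \<inter> \<iota> ` N"
      using E right_ideal_incl_image[OF N(1)]
      by (simp add: essential_right_ideal_def right_ideal_iff[OF R.ring_axioms])
    ultimately obtain n where n: "n \<in> N" "\<iota> n \<in> ?E" "\<iota> n \<noteq> \<zero>\<^bsub>R\<^esub>" by blast
    have nS: "n \<in> carrier S" using n Nsub by auto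
    \<comment> \<open>Projecting \<iota>(x)\<iota>(n), which lies in K, puts xn into the image of
      K.\<close>
    have "x \<otimes>\<^bsub>S\<^esub> n = \<pi> (\<iota> x \<otimes>\<^bsub>R\<^esub> \<iota> n)"
      using nS x by (simp add: incl_closed proj_incl)
    then have "n \<in> ?F" using n(2) nS by blast
    moreover have "n \<noteq> \<zero>\<^bsub>S\<^esub>" using n(3) incl_zero by auto
    ultimately show "?F \<inter> N \<noteq> {\<zero>\<^bsub>S\<^esub>}" using n(1) by blast
  qed
qed

lemma delta_small_incl_image:
  assumes "delta_small S J"
  shows "delta_small R (\<iota> ` J)"
  unfolding delta_small_def
proof (intro conjI allI impI)
  have J: "right_ideal J S" using assms by (simp add: delta_small_def)
  then have Jsub: "J \<subseteq> carrier S" by (simp add: right_ideal_iff[OF S.ring_axioms])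
  show "right_ideal (\<iota> ` J) R" by (rule right_ideal_incl_image[OF J])
  fix K assume *: "right_ideal K R \<and> singular_module R (right_quotient R K) \<and>
    carrier R = \<iota> ` J <+>\<^bsub>R\<^esub> K"
  then have K: "right_ideal K R" and sing: "singular_module R (right_quotient R K)"
    and sum: "carrier R = \<iota> ` J <+>\<^bsub>R\<^esub> K" by iprover+
  have Ksub: "K \<subseteq> carrier R" and Kadd: "\<And>a b. a \<in> K \<Longrightarrow> b \<in> K \<Longrightarrow> a \<oplus>\<^bsub>R\<^esub> b \<in> K"
    and Kmult: "\<And>a x. a \<in> K \<Longrightarrow> x \<in> carrier R \<Longrightarrow> a \<otimes>\<^bsub>R\<^esub> x \<in> K"
    using K by (simp_all add: right_ideal_iff[OF R.ring_axioms])
  \<comment> \<open>The decomposition of \<iota>(y) in \<open>R\<close> projects to one of y in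
    \<open>S\<close>.\<close>
  have "carrier S = J <+>\<^bsub>S\<^esub> \<pi> ` K"
  proof
    show "carrier S \<subseteq> J <+>\<^bsub>S\<^esub> \<pi> ` K"
    proof
      fix y assume y: "y \<in> carrier S"
      then have "\<iota> y \<in> \<iota> ` J <+>\<^bsub>R\<^esub> K" using incl_closed sum by simp
      then obtain j k where jk: "j \<in> J" "k \<in> K" "\<iota> y = \<iota> j \<oplus>\<^bsub>R\<^esub> k"
        by (auto simp: set_add_def')
      have c: "j \<in> carrier S" "k \<in> carrier R" using jk Jsub Ksub by auto
      have "y = \<pi> (\<iota> j \<oplus>\<^bsub>R\<^esub> k)" using proj_incl[OF y] jk(3) by simp
      also have "\<dots> = j \<oplus>\<^bsub>S\<^esub> \<pi> k" using c by (simp add: incl_closed proj_incl)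
      finally show "y \<in> J <+>\<^bsub>S\<^esub> \<pi> ` K" using jk unfolding set_add_def' by blast
    qed
    show "J <+>\<^bsub>S\<^esub> \<pi> ` K \<subseteq> carrier S"
      using Jsub right_ideal_image[OF K]
      by (intro S.set_add_closed) (simp_all add: right_ideal_iff[OF S.ring_axioms])
  qed
  then have "carrier S = \<pi> ` K"
    using assms right_ideal_image[OF K] singular_quotient_proj_image[OF K sing]
    unfolding delta_small_def by blast
  \<comment> \<open>A lift k of 1 inside K satisfies k\<iota>(1) = \<iota>(\<pi>(k)1) = \<iota>(1),
    which therefore lies in K.\<close>
  then obtain k where k: "k \<in> K" "\<pi> k = \<one>\<^bsub>S\<^esub>" using S.one_closed by (metis imageE)
  have one_K: "\<iota> \<one>\<^bsub>S\<^esub> \<in> K"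
    using Kmult[OF k(1) incl_closed[OF S.one_closed]] incl_mult_left[of "\<one>\<^bsub>S\<^esub>" k] k Ksub by auto
  \<comment> \<open>Here \<iota>(y) = \<iota>(1)\<iota>(y), so K contains the whole factor and
    absorbs the summand \<iota>(J).\<close>
  have incl_K: "\<iota> y \<in> K" if y: "y \<in> carrier S" for y
    using Kmult[OF one_K incl_closed[OF y]] incl_mult_right[OF S.one_closed incl_closed[OF y]] y
    by (simp add: proj_incl)
  have "\<iota> ` J <+>\<^bsub>R\<^esub> K \<subseteq> K"
    using incl_K Jsub Kadd by (auto simp: set_add_def')
  then show "carrier R = K" using sum Ksub by simp
qed

lemma delta_incl_image: "\<iota> ` delta S \<subseteq> delta R"
  by (rule delta_image_subset[OF incl_group_hom delta_small_incl_image])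

text \<open>The element \<iota>(a) lifts a. Its witness p projects to one for a, because \<pi>
  preserves commutation and idempotence and maps \<delta>(R) into \<delta>(S).\<close>

lemma weakly_delta_quasipolar_factor:
  assumes "weakly_delta_quasipolar R"
  shows "weakly_delta_quasipolar S"
  unfolding weakly_delta_quasipolar_def weakly_delta_quasipolar_element_def
proof
  fix a assume a: "a \<in> carrier S"
  then obtain p where p: "p \<in> carrier R" "p \<otimes>\<^bsub>R\<^esub> \<iota> a = \<iota> a \<otimes>\<^bsub>R\<^esub> p" "p \<otimes>\<^bsub>R\<^esub> p = p"
      "\<iota> a \<oplus>\<^bsub>R\<^esub> p \<in> delta R"
    using assms incl_closed[OF a]
    unfolding weakly_delta_quasipolar_def weakly_delta_quasipolar_element_def comm_def by blast
  have "\<pi> p \<otimes>\<^bsub>S\<^esub> a = a \<otimes>\<^bsub>S\<^esub> \<pi> p"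
    using arg_cong[OF p(2), of \<pi>] a p(1) by (simp add: incl_closed proj_incl)
  then have "\<pi> p \<in> comm S a" using p(1) by (simp add: comm_def)
  moreover have "\<pi> p \<otimes>\<^bsub>S\<^esub> \<pi> p = \<pi> p" using p(1,3) by (metis hom_mult)
  moreover have "a \<oplus>\<^bsub>S\<^esub> \<pi> p \<in> delta S"
  proof -
    have "\<pi> (\<iota> a \<oplus>\<^bsub>R\<^esub> p) = a \<oplus>\<^bsub>S\<^esub> \<pi> p" using a p(1) by (simp add: incl_closed proj_incl)
    then show ?thesis using delta_image p(4) by force
  qed
  ultimately show "\<exists>p\<in>comm S a. p \<otimes>\<^bsub>S\<^esub> p = p \<and> a \<oplus>\<^bsub>S\<^esub> p \<in> delta S" by blast
qed

end

section \<open>Products of lists of rings\<close>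

lemma RDirProd_list_Cons_mem_iff:
  "a # as \<in> carrier (RDirProd_list (R # Rs)) \<longleftrightarrow> a \<in> carrier R \<and> as \<in> carrier (RDirProd_list Rs)"
  by (auto simp: RDirProd_list_carrier)

lemma RDirProd_list_Cons_simps:
  assumes "a \<in> carrier R" "b \<in> carrier R"
    and "as \<in> carrier (RDirProd_list Rs)" "bs \<in> carrier (RDirProd_list Rs)"
  shows "(a # as) \<otimes>\<^bsub>RDirProd_list (R # Rs)\<^esub> (b # bs) =
      (a \<otimes>\<^bsub>R\<^esub> b) # (as \<otimes>\<^bsub>RDirProd_list Rs\<^esub> bs)"
    and "(a # as) \<oplus>\<^bsub>RDirProd_list (R # Rs)\<^esub> (b # bs) =
      (a \<oplus>\<^bsub>R\<^esub> b) # (as \<oplus>\<^bsub>RDirProd_list Rs\<^esub> bs)"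
proof -
  \<comment> \<open>By \<open>RDirProd_list_hom1\<close>, (a, as) \<mapsto> a # as is a ring
    homomorphism from the binary product, so its componentwise operations carry over to
    lists.\<close>
  let ?P = "RDirProd R (RDirProd_list Rs)"
  have c: "(a, as) \<in> carrier ?P" "(b, bs) \<in> carrier ?P"
    using assms by (auto simp: RDirProd_carrier)
  have "(a, as) \<otimes>\<^bsub>?P\<^esub> (b, bs) = (a \<otimes>\<^bsub>R\<^esub> b, as \<otimes>\<^bsub>RDirProd_list Rs\<^esub> bs)"
    "(a, as) \<oplus>\<^bsub>?P\<^esub> (b, bs) = (a \<oplus>\<^bsub>R\<^esub> b, as \<oplus>\<^bsub>RDirProd_list Rs\<^esub> bs)"
    by (simp_all add: RDirProd_def DirProd_def monoid.defs)
  then show "(a # as) \<otimes>\<^bsub>RDirProd_list (R # Rs)\<^esub> (b # bs) =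
      (a \<otimes>\<^bsub>R\<^esub> b) # (as \<otimes>\<^bsub>RDirProd_list Rs\<^esub> bs)"
    and "(a # as) \<oplus>\<^bsub>RDirProd_list (R # Rs)\<^esub> (b # bs) =
      (a \<oplus>\<^bsub>R\<^esub> b) # (as \<oplus>\<^bsub>RDirProd_list Rs\<^esub> bs)"
    using ring_hom_mult[OF RDirProd_list_hom1 c] ring_hom_add[OF RDirProd_list_hom1 c] by simp_all
qed

lemma RDirProd_list_one_Cons:
  "\<one>\<^bsub>RDirProd_list (R # Rs)\<^esub> = \<one>\<^bsub>R\<^esub> # \<one>\<^bsub>RDirProd_list Rs\<^esub>"
  by (simp add: RDirProd_list_one)

lemma ring_RDirProd_list:
  assumes "\<And>R. R \<in> set Rs \<Longrightarrow> ring R"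
  shows "ring (RDirProd_list Rs)"
  using assms by (intro RDirProd_list_is_ring) simp

text \<open>Head and tail are both direct factors, included by padding with zero. Projection gives
  one direction; pairing the two witnesses gives the other.\<close>

lemma weakly_delta_quasipolar_RDirProd_list_Cons:
  assumes "ring R" "\<And>S. S \<in> set Rs \<Longrightarrow> ring S"
  shows "weakly_delta_quasipolar (RDirProd_list (R # Rs)) \<longleftrightarrow>
    weakly_delta_quasipolar R \<and> weakly_delta_quasipolar (RDirProd_list Rs)"
proof -
  let ?S = "RDirProd_list Rs" and ?P = "RDirProd_list (R # Rs)"
  interpret R: ring R by fact
  interpret S: ring ?S using assms(2) by (rule ring_RDirProd_list)
  interpret P: ring ?P by (rule ring_RDirProd_list) (use assms in auto)
  note simps = RDirProd_list_Cons_simps RDirProd_list_Cons_mem_iff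
  have car: "\<exists>a as. x = a # as \<and> a \<in> carrier R \<and> as \<in> carrier ?S" if "x \<in> carrier ?P" for x
    using that by (auto simp: RDirProd_list_carrier)
  interpret F: ring_direct_factor ?P R hd "\<lambda>a. a # \<zero>\<^bsub>?S\<^esub>"
  proof (intro ring_direct_factor.intro ring_direct_factor_axioms.intro ring_hom_ringI
      P.ring_axioms R.ring_axioms)
    fix x assume "x \<in> carrier ?P"
    then obtain a as where x: "x = a # as" "a \<in> carrier R" "as \<in> carrier ?S" using car by blast
    then show "hd x \<in> carrier R" by simp
    fix y assume "y \<in> carrier ?P"
    then obtain b bs where y: "y = b # bs" "b \<in> carrier R" "bs \<in> carrier ?S" using car by blast
    show "hd (x \<otimes>\<^bsub>?P\<^esub> y) = hd x \<otimes>\<^bsub>R\<^esub> hd y" "hd (x \<oplus>\<^bsub>?P\<^esub> y) = hd x \<oplus>\<^bsub>R\<^esub> hd y"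
      using x y by (simp_all add: simps)
  next
    fix b x assume b: "b \<in> carrier R" and "x \<in> carrier ?P"
    then obtain a as where x: "x = a # as" "a \<in> carrier R" "as \<in> carrier ?S" using car by blast
    show "(b # \<zero>\<^bsub>?S\<^esub>) \<otimes>\<^bsub>?P\<^esub> x = (b \<otimes>\<^bsub>R\<^esub> hd x) # \<zero>\<^bsub>?S\<^esub>"
      "x \<otimes>\<^bsub>?P\<^esub> (b # \<zero>\<^bsub>?S\<^esub>) = (hd x \<otimes>\<^bsub>R\<^esub> b) # \<zero>\<^bsub>?S\<^esub>"
      using x b by (simp_all add: simps)
  qed (simp_all add: simps RDirProd_list_one_Cons)
  interpret G: ring_direct_factor ?P ?S tl "\<lambda>as. \<zero>\<^bsub>R\<^esub> # as"
  proof (intro ring_direct_factor.intro ring_direct_factor_axioms.intro ring_hom_ringI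
      P.ring_axioms S.ring_axioms)
    fix x assume "x \<in> carrier ?P"
    then obtain a as where x: "x = a # as" "a \<in> carrier R" "as \<in> carrier ?S" using car by blast
    then show "tl x \<in> carrier ?S" by simp
    fix y assume "y \<in> carrier ?P"
    then obtain b bs where y: "y = b # bs" "b \<in> carrier R" "bs \<in> carrier ?S" using car by blast
    show "tl (x \<otimes>\<^bsub>?P\<^esub> y) = tl x \<otimes>\<^bsub>?S\<^esub> tl y" "tl (x \<oplus>\<^bsub>?P\<^esub> y) = tl x \<oplus>\<^bsub>?S\<^esub> tl y"
      using x y by (simp_all add: simps)
  next
    fix bs x assume b: "bs \<in> carrier ?S" and "x \<in> carrier ?P"
    then obtain a as where x: "x = a # as" "a \<in> carrier R" "as \<in> carrier ?S" using car by blast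
    show "(\<zero>\<^bsub>R\<^esub> # bs) \<otimes>\<^bsub>?P\<^esub> x = \<zero>\<^bsub>R\<^esub> # (bs \<otimes>\<^bsub>?S\<^esub> tl x)"
      "x \<otimes>\<^bsub>?P\<^esub> (\<zero>\<^bsub>R\<^esub> # bs) = \<zero>\<^bsub>R\<^esub> # (tl x \<otimes>\<^bsub>?S\<^esub> bs)"
      using x b by (simp_all add: simps)
  qed (simp_all add: simps RDirProd_list_one_Cons)
  have "weakly_delta_quasipolar ?P" if R: "weakly_delta_quasipolar R" and S: "weakly_delta_quasipolar ?S"
    unfolding weakly_delta_quasipolar_def weakly_delta_quasipolar_element_def
  proof
    fix x assume "x \<in> carrier ?P"
    then obtain a as where x: "x = a # as" "a \<in> carrier R" "as \<in> carrier ?S" using car by blast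
    obtain p where p: "p \<in> carrier R" "p \<otimes>\<^bsub>R\<^esub> a = a \<otimes>\<^bsub>R\<^esub> p" "p \<otimes>\<^bsub>R\<^esub> p = p" "a \<oplus>\<^bsub>R\<^esub> p \<in> delta R"
      using R x(2)
      unfolding weakly_delta_quasipolar_def weakly_delta_quasipolar_element_def comm_def by blast
    obtain ps where ps: "ps \<in> carrier ?S" "ps \<otimes>\<^bsub>?S\<^esub> as = as \<otimes>\<^bsub>?S\<^esub> ps" "ps \<otimes>\<^bsub>?S\<^esub> ps = ps"
        "as \<oplus>\<^bsub>?S\<^esub> ps \<in> delta ?S"
      using S x(3)
      unfolding weakly_delta_quasipolar_def weakly_delta_quasipolar_element_def comm_def by blast
    \<comment> \<open>The sum of x and the paired witness splits into a head part and a tail part,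
      each the inclusion of an element of \<delta> of its factor.\<close>
    have "((a \<oplus>\<^bsub>R\<^esub> p) # \<zero>\<^bsub>?S\<^esub>) \<oplus>\<^bsub>?P\<^esub> (\<zero>\<^bsub>R\<^esub> # (as \<oplus>\<^bsub>?S\<^esub> ps)) \<in> delta ?P"
      using F.delta_incl_image G.delta_incl_image p(4) ps(4) by (intro add_mem_delta) auto
    then have "x \<oplus>\<^bsub>?P\<^esub> (p # ps) \<in> delta ?P"
      using x p(1) ps(1) by (simp add: simps)
    moreover have "p # ps \<in> comm ?P x" "(p # ps) \<otimes>\<^bsub>?P\<^esub> (p # ps) = p # ps"
      using x p ps by (simp_all add: comm_def simps)
    ultimately show "\<exists>p\<in>comm ?P x. p \<otimes>\<^bsub>?P\<^esub> p = p \<and> x \<oplus>\<^bsub>?P\<^esub> p \<in> delta ?P" by blast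
  qed
  then show ?thesis
    using F.weakly_delta_quasipolar_factor G.weakly_delta_quasipolar_factor by blast
qed

section \<open>Induction on the number of factors\<close>

text \<open>Base case: the empty product is the zero ring. Its only element is idempotent and lies
  in \<delta> as the neutral element of a generated subgroup.\<close>

lemma weakly_delta_quasipolar_nil_ring: "weakly_delta_quasipolar nil_ring"
proof -
  have "\<one>\<^bsub>add_monoid nil_ring\<^esub> \<in> delta nil_ring"
    unfolding delta_def by (rule generate.one)
  then show ?thesis
    by (auto simp: weakly_delta_quasipolar_def weakly_delta_quasipolar_element_def comm_def monoid.defs)
qed

lemma weakly_delta_quasipolar_RDirProd_list:
  assumes "\<And>R. R \<in> set Rs \<Longrightarrow> ring R"
  shows "weakly_delta_quasipolar (RDirProd_list Rs) \<longleftrightarrow> (\<forall>R\<in>set Rs. weakly_delta_quasipolar R)"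
  using assms
  by (induction Rs) (simp_all add: weakly_delta_quasipolar_nil_ring weakly_delta_quasipolar_RDirProd_list_Cons)

theorem proposition3p7:
  fixes n :: nat and R :: "nat \<Rightarrow> ('a, 'm) ring_scheme"
  assumes "\<And>i. i \<in> {1..n} \<Longrightarrow> ring (R i)"
  shows "weakly_delta_quasipolar (RDirProd_list (map R [1..<Suc n])) \<longleftrightarrow>
    (\<forall>i\<in>{1..n}. weakly_delta_quasipolar (R i))"
proof -
  \<comment> \<open>The half-open range \<open>[1..<Suc n]\<close> runs through exactly 1, ..., n;
    for n = 0 the list is empty and the product is the zero ring.\<close>
  have "set (map R [1..<Suc n]) = R ` {1..n}" by auto
  moreover have "ring S" if "S \<in> R ` {1..n}" for S using that assms by blast
  ultimately show ?thesis
    using weakly_delta_quasipolar_RDirProd_list[of "map R [1..<Suc n]"]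
    by (simp del: upt_Suc)
qed

end
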